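(* Given a set of $n$ total coins of which an unknown number $k$, $0\le k\le n$, are fake, and an integer $m>1$, any oblivious coin-weighing algorithm that determines whether $k$ is a multiple of $m$ requires at least $\Omega\bigl(\frac{\sqrt{n}}{m}+o(1)\bigr)$ measurements. That is, there is an absolute constant $c>0$ such that for each fixed integer $m>1$ the number of measurements is at least $c\bigl(\frac{\sqrt n}{m}+o(1)\bigr)$, where $o(1)\to0$ as $n\to\infty$.
   Context: All genuine coins have the same weight $w_1$ and all fake coins have the same weight $w_0<w_1$. A configuration of the coins is a vector $x\in\{0,1\}^n$ with $x_i=1$ if coin $i$ is genuine and $x_i=0$ if it is fake; $k$ is the number of zeros of $x$, and every configuration in $\{0,1\}^n$ is possible. A measurement is a weighing on a two-pan balance scale with equally many coins on each pan: a nonzero vector $\mathbf{h}\in\{-1,0,1\}^n$ with $\sum_i h_i=0$ ($-1$: left pan, $1$: right pan, $0$: not weighed), whose result is $\mathrm{sign}(x\cdot\mathbf{h})\in\{-1,0,1\}$. An algorithm is oblivious if all its weighings are fixed in advance, before any results are seen. It determines whether $k$ is a multiple of $m$ if for every $x\in\{0,1\}^n$ the answer is determined by the sequence of results ($0$ counts as a multiple of $m$). *)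

theory Defs
  imports Complex_Main "HOL-Library.FuncSet"
begin

text \<open>
  The set \<open>{0,1}\<^sup>n\<close> of configurations: coin \<open>i < n\<close> is genuine if \<open>x i = 1\<close> and fake if \<open>x i = 0\<close>.
\<close>

definition configurations :: "nat \<Rightarrow> (nat \<Rightarrow> int) set" where
  "configurations n = {..<n} \<rightarrow>\<^sub>E {0, 1}"

definition num_fake :: "nat \<Rightarrow> (nat \<Rightarrow> int) \<Rightarrow> nat" where
  "num_fake n x = card {i. i < n \<and> x i = 0}"

text \<open>
  Coin \<open>i\<close> is on the left pan if \<open>h i = -1\<close>, on the right pan if \<open>h i = 1\<close>, and is not
  weighed if \<open>h i = 0\<close>; the sum condition says that both pans hold equally many coins.
\<close>

definition measurements :: "nat \<Rightarrow> (nat \<Rightarrow> int) set" where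
  "measurements n =
     {h \<in> {..<n} \<rightarrow>\<^sub>E {-1, 0, 1}. (\<exists>i<n. h i \<noteq> 0) \<and> (\<Sum>i<n. h i) = 0}"

text \<open>
  With genuine weight \<open>w\<^sub>1\<close> and fake weight \<open>w\<^sub>0 < w\<^sub>1\<close>, the right pan outweighs the left one
  by \<open>(w\<^sub>1 - w\<^sub>0) * (x \<cdot> h)\<close>, as the entries of \<open>h\<close> sum to \<open>0\<close>. Hence the weights
  do not occur below.
\<close>

definition result :: "nat \<Rightarrow> (nat \<Rightarrow> int) \<Rightarrow> (nat \<Rightarrow> int) \<Rightarrow> int" where
  "result n x h = sgn (\<Sum>i<n. x i * h i)"

text \<open>An oblivious algorithm is the list of its weighings, fixed before any result is seen.\<close>

definition oblivious_algorithm :: "nat \<Rightarrow> (nat \<Rightarrow> int) list \<Rightarrow> bool" where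
  "oblivious_algorithm n hs \<longleftrightarrow> set hs \<subseteq> measurements n"

definition results :: "nat \<Rightarrow> (nat \<Rightarrow> int) list \<Rightarrow> (nat \<Rightarrow> int) \<Rightarrow> int list" where
  "results n hs x = map (result n x) hs"

definition determines_multiple :: "nat \<Rightarrow> nat \<Rightarrow> (nat \<Rightarrow> int) list \<Rightarrow> bool" where
  "determines_multiple n m hs \<longleftrightarrow>
     (\<exists>answer :: int list \<Rightarrow> bool.
        \<forall>x \<in> configurations n. answer (results n hs x) \<longleftrightarrow> m dvd num_fake n x)"

end

theory Submission
  imports Defs
begin

text \<open>
  Changing the type of one coin changes \<open>k\<close> by one. So if \<open>m > 1\<close> divides the number of
  fake coins of \<open>x\<close>, it does not divide that of any of the \<open>n\<close> neighbours of \<open>x\<close> in the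
  hypercube, and each of these \<open>n\<close> edges has to be cut by some weighing, i.e. its two
  endpoints give different results. The proof counts edges.

  A single weighing cuts few edges (\<open>card_cut_le\<close>). This is the classical bound
  \<open>O(\<surd>n)\<close> on the total influence of a threshold function: the result is the sign of a sum that
  has increments \<open>d = h i * (2 * x i - 1)\<close>, so along each edge the result changes in the
  direction of \<open>d\<close>, and the number of cut edges is bounded by a correlation of the result with
  \<open>\<Sum>i. h i * (2 * x i - 1)\<close>. As the result is the sign of this very sum, the correlation is the
  first absolute moment of a sum of at most \<open>n\<close> pairwise uncorrelated signs, which
  is at most \<open>\<surd>n\<close> (\<open>sum_abs_signed_sum_le\<close>).

  Together this shows that the number of weighings is at least \<open>\<surd>n / 2\<close> times the proportion of
  configurations whose number of fake coins is a multiple of \<open>m\<close>. The roots-of-unity filter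
  shows that this proportion is \<open>1 / m\<close> up to an exponentially small error
  (\<open>multiple_density_error\<close>), so even \<open>\<surd>n\<close> times the error tends to \<open>0\<close>.
\<close>

section \<open>The hypercube of configurations\<close>

definition flip :: "nat \<Rightarrow> (nat \<Rightarrow> int) \<Rightarrow> nat \<Rightarrow> int" where
  "flip i x = x(i := 1 - x i)"

lemma configurations_values:
  assumes "x \<in> configurations n" "i < n"
  shows "x i = 0 \<or> x i = 1"
  using assms by (auto simp: configurations_def PiE_iff)

lemma finite_configurations: "finite (configurations n)"
  by (simp add: configurations_def finite_PiE)

lemma card_configurations: "card (configurations n) = 2 ^ n"
  by (simp add: configurations_def card_PiE numeral_2_eq_2)

lemma flip_in_configurations:
  assumes "x \<in> configurations n" "i < n"
  shows "flip i x \<in> configurations n"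
  using assms by (auto simp: configurations_def flip_def PiE_iff extensional_def)

lemma flip_flip [simp]: "flip i (flip i x) = x"
  by (simp add: flip_def)

lemma sum_configurations_flip:
  assumes "i < n"
  shows "(\<Sum>x\<in>configurations n. g (flip i x)) = (\<Sum>x\<in>configurations n. g x)"
  by (rule sum.reindex_bij_witness[where i = "flip i" and j = "flip i"])
    (simp_all add: flip_in_configurations assms)

lemma not_dvd_num_fake_flip:
  assumes x: "x \<in> configurations n" and i: "i < n"
    and m: "m > 1" and dvd: "m dvd num_fake n x"
  shows "\<not> m dvd num_fake n (flip i x)"
proof -
  let ?Z = "\<lambda>x. {j. j < n \<and> x j = (0::int)}"
  have fin: "finite (?Z y)" for y by simp
  consider "x i = 0" | "x i = 1" using configurations_values[OF x i] by blast
  then show ?thesis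
  proof cases
    case 1
    then have "?Z x = insert i (?Z (flip i x))" "i \<notin> ?Z (flip i x)"
      using i by (auto simp: flip_def split: if_splits)
    then have "num_fake n x = Suc (num_fake n (flip i x))"
      unfolding num_fake_def by simp
    then show ?thesis
      using dvd m dvd_add_right_iff[of m "num_fake n (flip i x)" 1] by auto
  next
    case 2
    then have "?Z (flip i x) = insert i (?Z x)" "i \<notin> ?Z x"
      using i by (auto simp: flip_def split: if_splits)
    then have "num_fake n (flip i x) = Suc (num_fake n x)"
      unfolding num_fake_def by simp
    then show ?thesis
      using dvd m dvd_add_right_iff[of m "num_fake n x" 1] by auto
  qed
qed

section \<open>Moments of a signed sum\<close>

text \<open>Flipping coin \<open>i\<close> negates the product of the two signs, so the sum is its own negative.\<close>

lemma sum_signs_uncorrelated: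
  assumes "i < n" "i \<noteq> j"
  shows "(\<Sum>x\<in>configurations n. (2 * x i - 1) * (2 * x j - 1)) = 0"
proof -
  let ?g = "\<lambda>x::nat \<Rightarrow> int. (2 * x i - 1) * (2 * x j - 1)"
  have "(\<Sum>x\<in>configurations n. ?g x) = (\<Sum>x\<in>configurations n. ?g (flip i x))"
    using sum_configurations_flip[OF assms(1), of ?g] by simp
  also have "\<dots> = (\<Sum>x\<in>configurations n. - ?g x)"
    using assms(2) by (intro sum.cong) (auto simp: flip_def algebra_simps)
  finally show ?thesis by (simp add: sum_negf)
qed

lemma sum_square_signed_sum:
  "(\<Sum>x\<in>configurations n. (\<Sum>i<n. h i * (2 * x i - 1))\<^sup>2) = 2 ^ n * (\<Sum>i<n. (h i)\<^sup>2)"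
proof -
  have "(\<Sum>x\<in>configurations n. (\<Sum>i<n. h i * (2 * x i - 1))\<^sup>2)
      = (\<Sum>x\<in>configurations n. \<Sum>i<n. \<Sum>j<n. h i * h j * ((2 * x i - 1) * (2 * x j - 1)))"
    by (simp add: power2_eq_square sum_product mult_ac)
  also have "\<dots> = (\<Sum>i<n. \<Sum>j<n. \<Sum>x\<in>configurations n.
      h i * h j * ((2 * x i - 1) * (2 * x j - 1)))"
    by (subst sum.swap, rule sum.cong[OF refl], rule sum.swap)
  also have "\<dots> = (\<Sum>i<n. \<Sum>j<n. if i = j then 2 ^ n * (h i)\<^sup>2 else 0)"
  proof (intro sum.cong refl)
    fix i j assume ij: "i \<in> {..<n}" "j \<in> {..<n}"
    have "(\<Sum>x\<in>configurations n. (2 * x i - 1) * (2 * x j - 1)) = (if i = j then 2 ^ n else 0)"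
    proof (cases "i = j")
      case True
      have "(2 * x i - 1) * (2 * x i - 1) = 1" if "x \<in> configurations n" for x
        using configurations_values[OF that, of i] ij by auto
      then show ?thesis using True by (simp add: card_configurations)
    next
      case False
      then show ?thesis using sum_signs_uncorrelated[of i n j] ij by simp
    qed
    then show "(\<Sum>x\<in>configurations n. h i * h j * ((2 * x i - 1) * (2 * x j - 1)))
        = (if i = j then 2 ^ n * (h i)\<^sup>2 else 0)"
      by (simp add: power2_eq_square flip: sum_distrib_left)
  qed
  also have "\<dots> = 2 ^ n * (\<Sum>i<n. (h i)\<^sup>2)"
    by (simp add: sum_distrib_left)
  finally show ?thesis .
qed

lemma sum_abs_signed_sum_le:
  assumes h: "\<And>i. i < n \<Longrightarrow> \<bar>h i\<bar> \<le> (1::int)"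
  shows "real_of_int (\<Sum>x\<in>configurations n. \<bar>\<Sum>i<n. h i * (2 * x i - 1)\<bar>) \<le> 2 ^ n * sqrt n"
proof (cases "n = 0")
  case False
  let ?S = "\<lambda>x. \<Sum>i<n. h i * (2 * x i - 1)"
  define r where "r = sqrt (real n)"
  have r: "r > 0" "r * r = real n" using False by (simp_all add: r_def)
  have "(\<Sum>i<n. (h i)\<^sup>2) \<le> (\<Sum>i<n. 1)"
    using h by (intro sum_mono) (simp add: abs_square_le_1)
  then have "(\<Sum>i<n. (h i)\<^sup>2) \<le> int n" by simp
  then have "(\<Sum>x\<in>configurations n. (?S x)\<^sup>2) \<le> 2 ^ n * int n"
    unfolding sum_square_signed_sum by simp
  then have "real_of_int (\<Sum>x\<in>configurations n. (?S x)\<^sup>2) \<le> real_of_int (2 ^ n * int n)"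
    by (simp only: of_int_le_iff)
  then have sq: "(\<Sum>x\<in>configurations n. (real_of_int (?S x))\<^sup>2) \<le> 2 ^ n * (r * r)"
    by (simp add: r)
  \<comment> \<open>With the mean of the squares at most \<open>r\<^sup>2\<close>, this form of AM-GM replaces Cauchy-Schwarz.\<close>
  have "2 * r * \<bar>real_of_int (?S x)\<bar> \<le> (real_of_int (?S x))\<^sup>2 + r * r" for x
    using sum_squares_bound[of r "\<bar>real_of_int (?S x)\<bar>"] by (simp add: power2_eq_square)
  then have "(\<Sum>x\<in>configurations n. 2 * r * \<bar>real_of_int (?S x)\<bar>)
      \<le> (\<Sum>x\<in>configurations n. (real_of_int (?S x))\<^sup>2 + r * r)"
    by (intro sum_mono)
  also have "\<dots> \<le> 2 * r * (2 ^ n * r)"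
    using sq by (simp only: sum.distrib sum_constant card_configurations) (simp add: mult_ac)
  finally have "2 * r * (\<Sum>x\<in>configurations n. \<bar>real_of_int (?S x)\<bar>) \<le> 2 * r * (2 ^ n * r)"
    by (simp only: sum_distrib_left)
  then have "(\<Sum>x\<in>configurations n. \<bar>real_of_int (?S x)\<bar>) \<le> 2 ^ n * r"
    using r by simp
  then show ?thesis by (simp only: r_def of_int_sum of_int_abs)
qed (simp add: configurations_def)

section \<open>Edges cut by one weighing\<close>

text \<open>
  Each cut edge of the hypercube occurs twice, once from each endpoint. In this form the
  involution \<open>flip i\<close> acts on the edges in direction \<open>i\<close>.
\<close>

definition cut :: "nat \<Rightarrow> (nat \<Rightarrow> int) \<Rightarrow> ((nat \<Rightarrow> int) \<times> nat) set" where
  "cut n h = {(x, i). x \<in> configurations n \<and> i < n \<and> result n x h \<noteq> result n (flip i x) h}"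

lemma measurements_values:
  assumes "h \<in> measurements n" "i < n"
  shows "h i \<in> {-1, 0, 1}"
  using assms unfolding measurements_def by blast

text \<open>
  Flipping coin \<open>i\<close> decreases the weighed sum by \<open>d = h i * (2 * x i - 1)\<close>. The sign is
  monotone, so if the result changes at all, it decreases by a nonzero integer of the same sign
  as \<open>d\<close>.
\<close>

lemma cut_le_correlation:
  assumes h: "h \<in> measurements n" and x: "x \<in> configurations n" and i: "i < n"
  shows "of_bool ((x, i) \<in> cut n h)
    \<le> h i * (2 * x i - 1) * (result n x h - result n (flip i x) h)"
proof -
  define d where "d = h i * (2 * x i - 1)"
  define f where "f = (\<Sum>j<n. x j * h j)"
  define f' where "f' = (\<Sum>j<n. flip i x j * h j)"
  have hi: "h i \<in> {-1, 0, 1}"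
    by (rule measurements_values[OF h i])
  have d: "d \<in> {-1, 0, 1}"
    using hi configurations_values[OF x i] by (auto simp: d_def)
  have "f - f' = (\<Sum>j<n. if j = i then d else 0)"
    unfolding f_def f'_def sum_subtractf[symmetric]
    by (intro sum.cong) (auto simp: flip_def d_def algebra_simps)
  also have "\<dots> = d" using i by simp
  finally have f: "f = f' + d" by simp
  have "of_bool (sgn f \<noteq> sgn f') \<le> d * (sgn f - sgn f')"
    using d unfolding f by (auto simp: sgn_if)
  then show ?thesis
    using x i by (simp add: cut_def result_def d_def f_def f'_def)
qed

lemma finite_cut: "finite (cut n h)"
  by (rule finite_subset[of _ "configurations n \<times> {..<n}"])
    (auto simp: cut_def finite_configurations)

text \<open>
  Summing the previous bound over all edges, the involution \<open>flip i\<close> turns the difference of the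
  two results into twice the correlation of the result with \<open>h i * (2 * x i - 1)\<close>, since it
  negates the latter. The sum over \<open>i\<close> of these correlations is an absolute moment.
\<close>

lemma card_cut_le:
  assumes h: "h \<in> measurements n"
  shows "real (card (cut n h)) \<le> 2 * 2 ^ n * sqrt n"
proof -
  let ?C = "configurations n"
  let ?e = "\<lambda>x i. h i * (2 * x i - 1)"
  let ?r = "\<lambda>x. result n x h"
  have "(?C \<times> {..<n}) \<inter> cut n h = cut n h" by (auto simp: cut_def)
  then have "int (card (cut n h)) = (\<Sum>p\<in>?C \<times> {..<n}. of_bool (p \<in> cut n h))"
    by (simp add: finite_configurations sum.If_cases of_bool_def)
  also have "\<dots> = (\<Sum>x\<in>?C. \<Sum>i<n. of_bool ((x, i) \<in> cut n h))"
    by (simp only: sum.cartesian_product split_def prod.collapse)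
  also have "\<dots> = (\<Sum>i<n. \<Sum>x\<in>?C. of_bool ((x, i) \<in> cut n h))"
    by (rule sum.swap)
  also have "\<dots> \<le> (\<Sum>i<n. \<Sum>x\<in>?C. ?e x i * (?r x - ?r (flip i x)))"
    using cut_le_correlation[OF h] by (intro sum_mono) auto
  also have "\<dots> = (\<Sum>i<n. 2 * (\<Sum>x\<in>?C. ?e x i * ?r x))"
  proof (intro sum.cong refl)
    fix i assume "i \<in> {..<n}"
    then have i: "i < n" by simp
    have "(\<Sum>x\<in>?C. ?e x i * ?r (flip i x)) = (\<Sum>x\<in>?C. ?e (flip i x) i * ?r x)"
      using sum_configurations_flip[OF i, of "\<lambda>x. ?e (flip i x) i * ?r x"] by simp
    also have "\<dots> = - (\<Sum>x\<in>?C. ?e x i * ?r x)"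
      unfolding sum_negf[symmetric] by (intro sum.cong) (auto simp: flip_def algebra_simps)
    finally show "(\<Sum>x\<in>?C. ?e x i * (?r x - ?r (flip i x))) = 2 * (\<Sum>x\<in>?C. ?e x i * ?r x)"
      by (simp add: right_diff_distrib sum_subtractf)
  qed
  also have "\<dots> = 2 * (\<Sum>x\<in>?C. (\<Sum>i<n. ?e x i) * ?r x)"
    by (simp only: sum_distrib_left[symmetric] sum_distrib_right sum.swap[of _ "{..<n}"])
  also have "\<dots> = 2 * (\<Sum>x\<in>?C. \<bar>\<Sum>i<n. ?e x i\<bar>)"
  proof -
    have "(\<Sum>i<n. ?e x i) * ?r x = \<bar>\<Sum>i<n. ?e x i\<bar>" for x
    proof -
      \<comment> \<open>Here it matters that the pans hold equally many coins: shifting \<open>x\<close> from \<open>{0, 1}\<close> to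
          \<open>{-1, 1}\<close> only doubles the weighed sum.\<close>
      have "(\<Sum>i<n. h i) = 0" using h by (simp add: measurements_def)
      moreover have "(\<Sum>i<n. ?e x i) = 2 * (\<Sum>i<n. x i * h i) - (\<Sum>i<n. h i)"
        by (simp add: sum_distrib_left algebra_simps flip: sum_subtractf)
      ultimately have "(\<Sum>i<n. ?e x i) = 2 * (\<Sum>i<n. x i * h i)" by simp
      then show ?thesis by (simp add: result_def abs_mult abs_sgn sgn_mult)
    qed
    then show ?thesis by simp
  qed
  finally have "real_of_int (int (card (cut n h)))
      \<le> real_of_int (2 * (\<Sum>x\<in>?C. \<bar>\<Sum>i<n. ?e x i\<bar>))"
    by (simp only: of_int_le_iff)
  moreover have "\<bar>h i\<bar> \<le> 1" if "i < n" for i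
    using measurements_values[OF h that] by auto
  ultimately show ?thesis
    using sum_abs_signed_sum_le[of n h] by simp
qed

section \<open>Edges that must be cut\<close>

definition multiples :: "nat \<Rightarrow> nat \<Rightarrow> (nat \<Rightarrow> int) set" where
  "multiples n m = {x \<in> configurations n. m dvd num_fake n x}"

lemma edges_at_multiples_cut:
  assumes "m > 1" "determines_multiple n m hs"
  shows "multiples n m \<times> {..<n} \<subseteq> (\<Union>h\<in>set hs. cut n h)"
proof safe
  fix x i assume x: "x \<in> multiples n m" and i: "i < n"
  have xc: "x \<in> configurations n" "flip i x \<in> configurations n"
    using x i by (auto simp: multiples_def flip_in_configurations)
  have "m dvd num_fake n x" "\<not> m dvd num_fake n (flip i x)"
    using x i not_dvd_num_fake_flip[OF _ i assms(1)] by (auto simp: multiples_def)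
  then have "results n hs x \<noteq> results n hs (flip i x)"
    using assms(2) xc unfolding determines_multiple_def by metis
  then show "(x, i) \<in> (\<Union>h\<in>set hs. cut n h)"
    using xc i by (auto simp: results_def cut_def)
qed

lemma length_ge_multiple_density:
  assumes m: "m > 1" and alg: "oblivious_algorithm n hs" and det: "determines_multiple n m hs"
  shows "real (length hs) \<ge> sqrt n * (card (multiples n m) / 2 ^ n) / 2"
proof (cases "n = 0")
  case False
  have "n * card (multiples n m) = card (multiples n m \<times> {..<n})"
    by (simp add: card_cartesian_product)
  also have "\<dots> \<le> card (\<Union>h\<in>set hs. cut n h)"
    by (intro card_mono edges_at_multiples_cut[OF m det]) (simp add: finite_cut)
  also have "\<dots> \<le> (\<Sum>h\<in>set hs. card (cut n h))"
    by (rule card_UN_le) simp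
  finally have "real (n * card (multiples n m)) \<le> (\<Sum>h\<in>set hs. real (card (cut n h)))"
    unfolding of_nat_sum[symmetric] by (rule of_nat_mono)
  also have "\<dots> \<le> (\<Sum>h\<in>set hs. 2 * 2 ^ n * sqrt n)"
    using alg by (intro sum_mono card_cut_le) (auto simp: oblivious_algorithm_def)
  also have "\<dots> \<le> length hs * (2 * 2 ^ n * sqrt n)"
    using card_length[of hs] by (simp add: mult_right_mono)
  finally have "real n * card (multiples n m) \<le> real (length hs) * (2 * 2 ^ n * sqrt n)"
    by simp
  moreover have "real n * y = sqrt n * (sqrt n * y)" for y
    by (simp flip: mult.assoc)
  ultimately have "sqrt n * (sqrt n * card (multiples n m)) \<le> sqrt n * (real (length hs) * (2 * 2 ^ n))"
    by (simp only: mult_ac)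
  then have "sqrt n * card (multiples n m) \<le> real (length hs) * (2 * 2 ^ n)"
    using False by simp
  then show ?thesis by (simp add: field_simps)
qed simp

section \<open>The proportion of multiples\<close>

text \<open>
  The probability generating function of the number of fake coins, written unnormalised.
\<close>

lemma sum_power_num_fake:
  "(\<Sum>x\<in>configurations n. z ^ num_fake n x) = (1 + z :: complex) ^ n"
proof -
  have "(1 + z) ^ n = (\<Prod>i<n. \<Sum>b\<in>{0, 1::int}. if b = 0 then z else 1)"
    by (simp add: add.commute)
  also have "\<dots> = (\<Sum>x\<in>configurations n. \<Prod>i<n. if x i = 0 then z else 1)"
    unfolding configurations_def by (rule prod_sum_PiE) auto
  also have "\<dots> = (\<Sum>x\<in>configurations n. z ^ num_fake n x)"
  proof (intro sum.cong refl)
    fix x :: "nat \<Rightarrow> int"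
    have "{..<n} \<inter> {i. x i = 0} = {i. i < n \<and> x i = 0}" by auto
    then show "(\<Prod>i<n. if x i = 0 then z else 1) = z ^ num_fake n x"
      by (simp add: prod.If_cases num_fake_def)
  qed
  finally show ?thesis by simp
qed

lemma cis_eq_1_iff_dvd:
  assumes "m > 0"
  shows "cis (2 * pi * real k / real m) = 1 \<longleftrightarrow> m dvd k"
proof
  assume "m dvd k"
  then obtain q where "k = m * q" by blast
  then have "2 * pi * real k / real m = 2 * pi * real q" using assms by simp
  then show "cis (2 * pi * real k / real m) = 1"
    using cis_multiple_2pi[of "real q"] by simp
next
  assume "cis (2 * pi * real k / real m) = 1"
  then have "cos (2 * pi * real k / real m) = 1" by (metis cis.simps(1) one_complex.simps(1))
  then obtain q :: int where "2 * pi * real k / real m = of_int q * 2 * pi"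
    using cos_one_2pi_int by auto
  then have "real k = real_of_int q * real m"
    using assms by (simp add: field_simps)
  then have "real_of_int (int k) = real_of_int (q * int m)" by simp
  then have "int k = q * int m" by (simp only: of_int_eq_iff)
  then show "m dvd k" by (metis dvd_triv_right int_dvd_int_iff)
qed

lemma sum_roots_of_unity_power:
  assumes "m > 0"
  shows "(\<Sum>j<m. cis (2 * pi * real j / real m) ^ k) = (if m dvd k then of_nat m else 0)"
proof -
  let ?w = "cis (2 * pi * real k / real m)"
  have "(\<Sum>j<m. cis (2 * pi * real j / real m) ^ k) = (\<Sum>j<m. ?w ^ j)"
    by (intro sum.cong) (auto simp: DeMoivre mult_ac)
  moreover have "?w ^ m = 1"
    using assms cis_multiple_2pi[of "real k"] by (simp add: DeMoivre)
  ultimately show ?thesis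
    using cis_eq_1_iff_dvd[OF assms, of k] by (auto simp: geometric_sum)
qed

lemma card_multiples_root_filter:
  assumes "m > 0"
  shows "of_nat m * of_nat (card (multiples n m))
    = (\<Sum>j<m. (1 + cis (2 * pi * real j / real m)) ^ n)"
proof -
  let ?w = "\<lambda>j. cis (2 * pi * real j / real m)"
  have "(\<Sum>j<m. (1 + ?w j) ^ n) = (\<Sum>x\<in>configurations n. \<Sum>j<m. ?w j ^ num_fake n x)"
    unfolding sum_power_num_fake[symmetric] by (rule sum.swap)
  also have "\<dots> = (\<Sum>x\<in>configurations n. if m dvd num_fake n x then of_nat m else 0)"
    unfolding sum_roots_of_unity_power[OF assms] ..
  also have "\<dots> = of_nat m * of_nat (card (multiples n m))"
    unfolding multiples_def
    by (simp add: finite_configurations mult.commute flip: sum.inter_filter)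
  finally show ?thesis by simp
qed

text \<open>
  For \<open>z \<noteq> 1\<close> on the unit circle, strict convexity of the disc puts the midpoint of \<open>1\<close> and
  \<open>z\<close> in its interior. Quantitatively this is the parallelogram law.
\<close>

lemma norm_midpoint_unit_circle_less_1:
  assumes "norm z = 1" "z \<noteq> (1::complex)"
  shows "norm ((1 + z) / 2) < 1"
proof -
  have "(norm (1 + z))\<^sup>2 + (norm (1 - z))\<^sup>2 = 2 + 2 * (norm z)\<^sup>2"
    unfolding cmod_power2 by (simp add: power2_eq_square algebra_simps)
  moreover have "(norm (1 - z))\<^sup>2 > 0" using assms(2) by simp
  ultimately have "(norm (1 + z))\<^sup>2 < 2 + 2 * (norm z)\<^sup>2" by linarith
  then have "(norm (1 + z))\<^sup>2 < 2\<^sup>2" using assms(1) by simp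
  then have "norm (1 + z) < 2" by (rule power_less_imp_less_base) simp
  then show ?thesis by (simp add: norm_divide)
qed

text \<open>
  The root \<open>1\<close> contributes exactly \<open>1 / m\<close> to the filtered sum; every other root contributes
  the \<open>n\<close>-th power of a number of modulus below \<open>1\<close>.
\<close>

lemma multiple_density_error:
  assumes m: "m > 0"
  shows "(\<lambda>n. sqrt n * (card (multiples n m) / 2 ^ n - 1 / real m)) \<longlonglongrightarrow> 0"
proof -
  let ?u = "\<lambda>j. (1 + cis (2 * pi * real j / real m)) / 2"
  have density: "real m * (card (multiples n m) / 2 ^ n - 1 / real m) = Re (\<Sum>j\<in>{1..<m}. ?u j ^ n)"
    (is "?l n = _") for n
  proof -
    have "of_nat m * of_nat (card (multiples n m)) / 2 ^ n = (\<Sum>j<m. ?u j ^ n)"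
      unfolding card_multiples_root_filter[OF m] by (simp add: sum_divide_distrib power_divide)
    also have "\<dots> = 1 + (\<Sum>j\<in>{1..<m}. ?u j ^ n)"
      using m by (simp add: lessThan_atLeast0 sum.atLeast_Suc_lessThan)
    finally have "(\<Sum>j\<in>{1..<m}. ?u j ^ n) = of_real (?l n)"
      using m by (simp add: field_simps)
    then show ?thesis by simp
  qed
  have "(\<lambda>n. of_nat n * ?u j ^ n) \<longlonglongrightarrow> 0" if "j \<in> {1..<m}" for j
  proof (intro powser_times_n_limit_0 norm_midpoint_unit_circle_less_1)
    show "cis (2 * pi * real j / real m) \<noteq> 1"
      using cis_eq_1_iff_dvd[OF m, of j] that by (auto dest: dvd_imp_le)
  qed simp
  then have "(\<lambda>n. \<Sum>j\<in>{1..<m}. of_nat n * ?u j ^ n) \<longlonglongrightarrow> 0"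
    by (rule tendsto_null_sum)
  then have "(\<lambda>n. Re (\<Sum>j\<in>{1..<m}. of_nat n * ?u j ^ n)) \<longlonglongrightarrow> Re 0"
    by (rule tendsto_Re)
  moreover have "Re (\<Sum>j\<in>{1..<m}. of_nat n * ?u j ^ n) = real n * ?l n" for n
    unfolding density sum_distrib_left[symmetric] by simp
  ultimately have lim: "(\<lambda>n. real n * ?l n) \<longlonglongrightarrow> 0" by simp
  \<comment> \<open>The error decays exponentially, so nothing is lost by replacing \<open>\<surd>n\<close> by \<open>n\<close>.\<close>
  have bound: "\<bar>sqrt n * (card (multiples n m) / 2 ^ n - 1 / real m)\<bar> \<le> \<bar>real n * ?l n\<bar>" for n
  proof -
    have "sqrt n \<le> real n * real m"
    proof (cases "n = 0")
      case False
      then have "sqrt n \<le> sqrt (real n * real n)"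
        unfolding real_sqrt_le_iff by simp
      also have "\<dots> \<le> real n * real m" using m by (simp add: mult_le_cancel_left1)
      finally show ?thesis .
    qed simp
    then show ?thesis by (simp add: abs_mult mult_right_mono flip: mult.assoc)
  qed
  show ?thesis
    by (rule tendsto_0_le[OF lim, of _ 1]) (use bound in simp)
qed

section \<open>The lower bound\<close>

theorem theorem9:
  shows "\<exists>c::real. c > 0 \<and>
    (\<forall>m::nat. m > 1 \<longrightarrow>
      (\<exists>e :: nat \<Rightarrow> real. e \<longlonglongrightarrow> 0 \<and>
        (\<forall>(n::nat) (hs :: (nat \<Rightarrow> int) list).
           oblivious_algorithm n hs \<and> determines_multiple n m hs \<longrightarrow>
             real (length hs) \<ge> c * (sqrt (real n) / real m + e n))))"
proof (intro exI[of _ "1 / 2"] conjI allI impI)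
  fix m :: nat assume m: "m > 1"
  let ?e = "\<lambda>n. sqrt n * (card (multiples n m) / 2 ^ n - 1 / real m)"
  show "\<exists>e :: nat \<Rightarrow> real. e \<longlonglongrightarrow> 0 \<and>
        (\<forall>(n::nat) (hs :: (nat \<Rightarrow> int) list).
           oblivious_algorithm n hs \<and> determines_multiple n m hs \<longrightarrow>
             real (length hs) \<ge> 1 / 2 * (sqrt (real n) / real m + e n))"
  proof (intro exI[of _ ?e] conjI allI impI)
    show "?e \<longlonglongrightarrow> 0" using multiple_density_error m by simp
  next
    fix n hs assume "oblivious_algorithm n hs \<and> determines_multiple n m hs"
    then show "real (length hs) \<ge> 1 / 2 * (sqrt (real n) / real m + ?e n)"
      using length_ge_multiple_density[OF m, of n hs] by (simp add: right_diff_distrib)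
  qed
qed simp

end
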